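(* Let $\mathbf{R}=\langle R,+,\cdot,0,1,\alpha\rangle$ be an integral involutive near semiring and $e$ a central element of $\mathbf{R}$. Then $\mathbf{R}\cong\mathbf{[0,e]}\times\mathbf{[0,\alpha(e)]}$.
   Context: A near semiring is an algebra $\langle R,+,\cdot,0,1\rangle$ such that: (i) $\langle R,+,0\rangle$ is a commutative monoid; (ii) $x\cdot 1=x=1\cdot x$ (multiplication need not be associative or commutative); (iii) $(x+y)\cdot z=(x\cdot z)+(y\cdot z)$; (iv) $x\cdot 0=0\cdot x=0$. It is idempotent if $x+x=x$; then $x\le y$ iff $x+y=y$ defines a partial order, called the induced order. It is integral if $x+1=1$ for all $x$. An involutive near semiring is an idempotent near semiring with a map $\alpha:R\to R$ such that $\alpha(\alpha(x))=x$, and $x\le y$ implies $\alpha(y)\le\alpha(x)$. For $a,b\in R$, $\theta(a,b)$ denotes the congruence of $\mathbf{R}$ (with respect to $+,\cdot,\alpha,0,1$) generated by the pair $(a,b)$. An element $e\in R$ is central if $(\theta(e,0),\theta(e,1))$ is a pair of complementary factor congruences of $\mathbf{R}$, i.e. $\theta(e,0)\cap\theta(e,1)$ is the identity relation and $\theta(e,0)\circ\theta(e,1)=R\times R$. If $e$ is central, so is $\alpha(e)$. For a central element $e$, $[0,e]=\{x\in R: x\le e\}$ and $\mathbf{[0,e]}=\langle [0,e],+,\cdot,{}^{e},0,e\rangle$, where $+$ and $\cdot$ are the restrictions of the operations of $\mathbf{R}$, the unary operation (in the role of $\alpha$) is $x^{e}=e\cdot\alpha(x)$, and $e$ plays the role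 of the constant $1$. The algebra $\mathbf{[0,\alpha(e)]}$ is defined in the same way with $\alpha(e)$ in place of $e$. *)

theory Defs
  imports "HOL-Algebra.Chinese_Remainder"
begin

record 'a invol_alg = "'a ring" +
  invol :: "'a \<Rightarrow> 'a"

text \<open>
  HOL-Algebra's \<^locale>\<open>abelian_monoid\<close> says exactly that addition and zero form a commutative
  monoid on the carrier; it assumes nothing about multiplication. In particular multiplication
  is neither associative, nor commutative, nor right-distributive below.
\<close>

locale near_semiring = abelian_monoid R for R (structure) +
  assumes m_closed: "\<lbrakk>x \<in> carrier R; y \<in> carrier R\<rbrakk> \<Longrightarrow> x \<otimes> y \<in> carrier R"
    and one_closed: "\<one> \<in> carrier R"
    and r_one: "x \<in> carrier R \<Longrightarrow> x \<otimes> \<one> = x"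
    and l_one: "x \<in> carrier R \<Longrightarrow> \<one> \<otimes> x = x"
    and l_distr: "\<lbrakk>x \<in> carrier R; y \<in> carrier R; z \<in> carrier R\<rbrakk> \<Longrightarrow>
      (x \<oplus> y) \<otimes> z = (x \<otimes> z) \<oplus> (y \<otimes> z)"
    and r_null: "x \<in> carrier R \<Longrightarrow> x \<otimes> \<zero> = \<zero>"
    and l_null: "x \<in> carrier R \<Longrightarrow> \<zero> \<otimes> x = \<zero>"

locale idempotent_near_semiring = near_semiring +
  assumes add_idem: "x \<in> carrier R \<Longrightarrow> x \<oplus> x = x"

definition induced_le :: "('a, 'm) ring_scheme \<Rightarrow> 'a \<Rightarrow> 'a \<Rightarrow> bool" where
  "induced_le R x y \<longleftrightarrow> x \<oplus>\<^bsub>R\<^esub> y = y"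

locale involutive_near_semiring = idempotent_near_semiring R
  for R :: "('a, 'm) invol_alg_scheme" (structure) +
  assumes invol_closed: "x \<in> carrier R \<Longrightarrow> invol R x \<in> carrier R"
    and invol_invol: "x \<in> carrier R \<Longrightarrow> invol R (invol R x) = x"
    and invol_antitone: "\<lbrakk>x \<in> carrier R; y \<in> carrier R; induced_le R x y\<rbrakk> \<Longrightarrow>
      induced_le R (invol R y) (invol R x)"

locale integral_involutive_near_semiring = involutive_near_semiring +
  assumes integral: "x \<in> carrier R \<Longrightarrow> x \<oplus> \<one> = \<one>"

definition congruence_rel :: "('a, 'm) invol_alg_scheme \<Rightarrow> ('a \<times> 'a) set \<Rightarrow> bool" where
  "congruence_rel R r \<longleftrightarrow>
     equiv (carrier R) r \<and>
     (\<forall>x x' y y'. (x, x') \<in> r \<longrightarrow> (y, y') \<in> r \<longrightarrow> (x \<oplus>\<^bsub>R\<^esub> y, x' \<oplus>\<^bsub>R\<^esub> y') \<in> r) \<and>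
     (\<forall>x x' y y'. (x, x') \<in> r \<longrightarrow> (y, y') \<in> r \<longrightarrow> (x \<otimes>\<^bsub>R\<^esub> y, x' \<otimes>\<^bsub>R\<^esub> y') \<in> r) \<and>
     (\<forall>x x'. (x, x') \<in> r \<longrightarrow> (invol R x, invol R x') \<in> r)"

definition principal_congruence :: "('a, 'm) invol_alg_scheme \<Rightarrow> 'a \<Rightarrow> 'a \<Rightarrow> ('a \<times> 'a) set" where
  "principal_congruence R a b = \<Inter> {r. congruence_rel R r \<and> (a, b) \<in> r}"

lemma (in involutive_near_semiring) congruence_rel_principal_congruence:
  assumes "a \<in> carrier R" "b \<in> carrier R"
  shows "congruence_rel R (principal_congruence R a b)"
proof -
  let ?C = "{r. congruence_rel R r \<and> (a, b) \<in> r}"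
  have "equiv (carrier R) (carrier R \<times> carrier R)"
    unfolding equiv_def refl_on_def sym_def trans_def by blast
  then have "carrier R \<times> carrier R \<in> ?C"
    using assms by (simp add: congruence_rel_def m_closed invol_closed)
  then have sub: "\<Inter> ?C \<subseteq> carrier R \<times> carrier R" by blast
  have eqv: "\<And>r. r \<in> ?C \<Longrightarrow> equiv (carrier R) r"
    by (simp add: congruence_rel_def)
  have "equiv (carrier R) (\<Inter> ?C)"
  proof (rule equivI)
    show "refl_on (carrier R) (\<Inter> ?C)"
      by (rule refl_onI) (use eqv in \<open>auto simp: equiv_def refl_on_def\<close>)
    show "sym (\<Inter> ?C)"
      by (rule symI) (use eqv in \<open>auto simp: equiv_def elim: symE\<close>)
    show "trans (\<Inter> ?C)"
      by (rule transI) (use eqv in \<open>auto simp: equiv_def elim: transE\<close>)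
  qed (fact sub)
  moreover have "(x \<oplus> y, x' \<oplus> y') \<in> \<Inter> ?C" "(x \<otimes> y, x' \<otimes> y') \<in> \<Inter> ?C"
    if "(x, x') \<in> \<Inter> ?C" "(y, y') \<in> \<Inter> ?C" for x x' y y'
    using that by (simp_all add: congruence_rel_def)
  moreover have "(invol R x, invol R x') \<in> \<Inter> ?C" if "(x, x') \<in> \<Inter> ?C" for x x'
    using that by (simp add: congruence_rel_def)
  ultimately show ?thesis
    unfolding congruence_rel_def[of R "principal_congruence R a b"]
    unfolding principal_congruence_def by blast
qed

definition complementary_factor_congruences ::
  "('a, 'm) invol_alg_scheme \<Rightarrow> ('a \<times> 'a) set \<Rightarrow> ('a \<times> 'a) set \<Rightarrow> bool" where
  "complementary_factor_congruences R r s \<longleftrightarrow>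
     congruence_rel R r \<and> congruence_rel R s \<and>
     r \<inter> s = Id_on (carrier R) \<and> r O s = carrier R \<times> carrier R"

definition central :: "('a, 'm) invol_alg_scheme \<Rightarrow> 'a \<Rightarrow> bool" where
  "central R e \<longleftrightarrow> e \<in> carrier R \<and>
     complementary_factor_congruences R
       (principal_congruence R e \<zero>\<^bsub>R\<^esub>) (principal_congruence R e \<one>\<^bsub>R\<^esub>)"

definition interval_alg :: "('a, 'm) invol_alg_scheme \<Rightarrow> 'a \<Rightarrow> 'a invol_alg" where
  "interval_alg R e =
     \<lparr>carrier = {x \<in> carrier R. induced_le R x e}, mult = (\<otimes>\<^bsub>R\<^esub>), one = e,
      zero = \<zero>\<^bsub>R\<^esub>, add = (\<oplus>\<^bsub>R\<^esub>), invol = (\<lambda>x. e \<otimes>\<^bsub>R\<^esub> invol R x)\<rparr>"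

definition prod_alg ::
  "('a, 'm) invol_alg_scheme \<Rightarrow> ('b, 'n) invol_alg_scheme \<Rightarrow> ('a \<times> 'b) invol_alg" where
  "prod_alg R S = ring.extend (RDirProd R S) \<lparr>invol = (\<lambda>(x, y). (invol R x, invol S y))\<rparr>"

lemma prod_alg_simps [simp]:
  "carrier (prod_alg R S) = carrier R \<times> carrier S"
  "(x, y) \<oplus>\<^bsub>prod_alg R S\<^esub> (x', y') = (x \<oplus>\<^bsub>R\<^esub> x', y \<oplus>\<^bsub>S\<^esub> y')"
  "(x, y) \<otimes>\<^bsub>prod_alg R S\<^esub> (x', y') = (x \<otimes>\<^bsub>R\<^esub> x', y \<otimes>\<^bsub>S\<^esub> y')"
  "\<zero>\<^bsub>prod_alg R S\<^esub> = (\<zero>\<^bsub>R\<^esub>, \<zero>\<^bsub>S\<^esub>)"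
  "\<one>\<^bsub>prod_alg R S\<^esub> = (\<one>\<^bsub>R\<^esub>, \<one>\<^bsub>S\<^esub>)"
  "invol (prod_alg R S) (x, y) = (invol R x, invol S y)"
  by (simp_all add: prod_alg_def RDirProd_def DirProd_def ring.defs monoid.defs)

text \<open>
  \<^const>\<open>ring_iso\<close> covers the carrier bijection, addition, multiplication and one. A ring
  homomorphism in the library need not mention zero, so its preservation is required here.
  When the source is closed under its operations, an isomorphism forces the target to be
  closed as well; for a product of intervals this includes closure of each interval.
\<close>

definition alg_iso ::
  "('a, 'm) invol_alg_scheme \<Rightarrow> ('b, 'n) invol_alg_scheme \<Rightarrow> ('a \<Rightarrow> 'b) set" where
  "alg_iso R S = {h \<in> ring_iso R S. h \<zero>\<^bsub>R\<^esub> = \<zero>\<^bsub>S\<^esub> \<and>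
     (\<forall>x \<in> carrier R. h (invol R x) = invol S (h x))}"

definition isomorphic_algs ::
  "('a, 'm) invol_alg_scheme \<Rightarrow> ('b, 'n) invol_alg_scheme \<Rightarrow> bool" where
  "isomorphic_algs R S \<longleftrightarrow> alg_iso R S \<noteq> {}"

end

theory Submission
  imports Defs
begin

text \<open>
  Modulo \<open>\<theta>(e,0)\<close> the element \<open>e\<close> becomes \<open>0\<close> and its involute becomes \<open>1\<close>; modulo \<open>\<theta>(e,1)\<close> the
  roles are exchanged. As the two congruences meet in the identity, an identity holds in the
  algebra once it holds modulo each of them, where multiplication by \<open>e\<close> is either \<open>0\<close> or the
  identity map. In this way \<open>x \<mapsto> (e \<cdot> x, \<alpha>(e) \<cdot> x)\<close> is seen to be an isomorphism with
  inverse \<open>(a, b) \<mapsto> a + b\<close>.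
\<close>

lemma congruence_relD:
  assumes "congruence_rel R r"
  shows congruence_rel_closed: "(x, y) \<in> r \<Longrightarrow> x \<in> carrier R \<and> y \<in> carrier R"
    and congruence_rel_refl: "x \<in> carrier R \<Longrightarrow> (x, x) \<in> r"
    and congruence_rel_sym: "(x, y) \<in> r \<Longrightarrow> (y, x) \<in> r"
    and congruence_rel_trans: "(x, y) \<in> r \<Longrightarrow> (y, z) \<in> r \<Longrightarrow> (x, z) \<in> r"
    and congruence_rel_add:
      "(x, x') \<in> r \<Longrightarrow> (y, y') \<in> r \<Longrightarrow> (x \<oplus>\<^bsub>R\<^esub> y, x' \<oplus>\<^bsub>R\<^esub> y') \<in> r"
    and congruence_rel_mult:
      "(x, x') \<in> r \<Longrightarrow> (y, y') \<in> r \<Longrightarrow> (x \<otimes>\<^bsub>R\<^esub> y, x' \<otimes>\<^bsub>R\<^esub> y') \<in> r"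
    and congruence_rel_invol: "(x, x') \<in> r \<Longrightarrow> (invol R x, invol R x') \<in> r"
proof -
  have eq: "equiv (carrier R) r"
    using assms by (simp add: congruence_rel_def)
  show "(x, y) \<in> r \<Longrightarrow> x \<in> carrier R \<and> y \<in> carrier R"
    using equiv_type[OF eq] by blast
  show "x \<in> carrier R \<Longrightarrow> (x, x) \<in> r"
    using eq by (meson equivE refl_onD)
  show "(x, y) \<in> r \<Longrightarrow> (y, x) \<in> r"
    using eq by (meson equivE symD)
  show "(x, y) \<in> r \<Longrightarrow> (y, z) \<in> r \<Longrightarrow> (x, z) \<in> r"
    using eq by (meson equivE transD)
qed (use assms in \<open>simp_all add: congruence_rel_def\<close>)

context integral_involutive_near_semiring
begin

text \<open>Since 0 is the least element, antitonicity applied to 0 \<le> \<alpha>(1) puts 1 below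
  \<alpha>(0); by integrality 1 is the greatest element.\<close>

lemma invol_zero: "invol R \<zero> = \<one>"
proof -
  have "induced_le R \<zero> (invol R \<one>)"
    by (simp add: induced_le_def invol_closed one_closed)
  then have "\<one> \<oplus> invol R \<zero> = invol R \<zero>"
    using invol_antitone[of \<zero> "invol R \<one>"]
    by (simp add: induced_le_def invol_closed invol_invol one_closed)
  moreover have "\<one> \<oplus> invol R \<zero> = \<one>"
    by (metis a_comm integral invol_closed one_closed zero_closed)
  ultimately show ?thesis by simp
qed

lemma invol_one: "invol R \<one> = \<zero>"
  by (metis invol_invol invol_zero zero_closed)

end

text \<open>Arbitrary congruences take the place of the principal ones, so that the assumptions are
  symmetric under exchanging \<open>r\<close> with \<open>s\<close> and \<open>e\<close> with
  \<alpha>(e).\<close>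

locale congruence_splitting = integral_involutive_near_semiring R
  for R :: "('a, 'm) invol_alg_scheme" (structure) +
  fixes r s :: "('a \<times> 'a) set" and e :: 'a
  assumes cong_r: "congruence_rel R r" and cong_s: "congruence_rel R s"
    and e_zero: "(e, \<zero>) \<in> r" and e_one: "(e, \<one>) \<in> s"
    and meet: "r \<inter> s \<subseteq> Id"
begin

lemma e_closed: "e \<in> carrier R"
  using congruence_rel_closed[OF cong_r e_zero] by simp

text \<open>Applying \<alpha> to the two given pairs exchanges 0 and 1. Every fact about
  \<open>e\<close> below thus has a mirror image for \<alpha>(e).\<close>

lemma swap: "congruence_splitting R s r (invol R e)"
  using cong_r cong_s meet congruence_rel_invol[OF cong_r e_zero]
    congruence_rel_invol[OF cong_s e_one]
  by unfold_locales (auto simp: invol_zero invol_one)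

lemma eq_if_congruent: "(x, y) \<in> r \<Longrightarrow> (x, y) \<in> s \<Longrightarrow> x = y"
  using meet by blast

lemma eq_if_common:
  assumes "(x, u) \<in> r" "(y, u) \<in> r" "(x, v) \<in> s" "(y, v) \<in> s"
  shows "x = y"
  using assms eq_if_congruent
  by (meson cong_r cong_s congruence_rel_sym congruence_rel_trans)

lemma mult_e_r: "x \<in> carrier R \<Longrightarrow> (e \<otimes> x, \<zero>) \<in> r"
  using congruence_rel_mult[OF cong_r e_zero congruence_rel_refl[OF cong_r]]
  by (metis l_null)

lemma mult_e_s: "x \<in> carrier R \<Longrightarrow> (e \<otimes> x, x) \<in> s"
  using congruence_rel_mult[OF cong_s e_one congruence_rel_refl[OF cong_s]]
  by (metis l_one)

lemma mult_e_le:
  assumes x: "x \<in> carrier R"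
  shows "induced_le R (e \<otimes> x) e"
  unfolding induced_le_def
proof (rule eq_if_common)
  show "(e \<otimes> x \<oplus> e, \<zero>) \<in> r"
    using congruence_rel_add[OF cong_r mult_e_r[OF x] e_zero] by simp
  \<comment> \<open>Modulo \<open>s\<close> the sum becomes x + 1, which integrality collapses to
    1.\<close>
  show "(e \<otimes> x \<oplus> e, \<one>) \<in> s"
    using congruence_rel_add[OF cong_s mult_e_s[OF x] e_one] integral[OF x] by simp
qed (fact e_zero e_one)+

text \<open>Left distributivity is no axiom; for \<open>e\<close> it holds because both sides reduce
  to 0 modulo \<open>r\<close> and to x + y modulo \<open>s\<close>.\<close>

lemma mult_e_add:
  assumes x: "x \<in> carrier R" and y: "y \<in> carrier R"
  shows "e \<otimes> (x \<oplus> y) = e \<otimes> x \<oplus> e \<otimes> y"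
proof (rule eq_if_common)
  show "(e \<otimes> x \<oplus> e \<otimes> y, \<zero>) \<in> r"
    using congruence_rel_add[OF cong_r mult_e_r[OF x] mult_e_r[OF y]] by simp
qed (use x y in \<open>auto intro: mult_e_r mult_e_s congruence_rel_add[OF cong_s]\<close>)

lemma mult_e_mult:
  assumes x: "x \<in> carrier R" and y: "y \<in> carrier R"
  shows "e \<otimes> (x \<otimes> y) = (e \<otimes> x) \<otimes> (e \<otimes> y)"
proof (rule eq_if_common)
  show "((e \<otimes> x) \<otimes> (e \<otimes> y), \<zero>) \<in> r"
    using congruence_rel_mult[OF cong_r mult_e_r[OF x] mult_e_r[OF y]]
    by (simp add: r_null)
qed (use x y in \<open>auto intro: m_closed mult_e_r mult_e_s congruence_rel_mult[OF cong_s]\<close>)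

text \<open>The right-hand side is the involution of the interval below \<open>e\<close>, evaluated
  at \<open>e \<otimes> x\<close>. Modulo \<open>s\<close> the inner factor \<open>e\<close>
  disappears, and modulo \<open>r\<close> the outer one annihilates both sides.\<close>

lemma mult_e_invol:
  assumes x: "x \<in> carrier R"
  shows "e \<otimes> invol R x = e \<otimes> invol R (e \<otimes> x)"
proof (rule eq_if_common)
  have cl: "invol R x \<in> carrier R" "invol R (e \<otimes> x) \<in> carrier R"
    using x by (simp_all add: invol_closed m_closed e_closed)
  show "(e \<otimes> invol R x, \<zero>) \<in> r" "(e \<otimes> invol R (e \<otimes> x), \<zero>) \<in> r"
    "(e \<otimes> invol R x, invol R x) \<in> s"
    using cl by (auto intro: mult_e_r mult_e_s)
  show "(e \<otimes> invol R (e \<otimes> x), invol R x) \<in> s"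
    by (rule congruence_rel_trans[OF cong_s mult_e_s[OF cl(2)]
          congruence_rel_invol[OF cong_s mult_e_s[OF x]]])
qed

text \<open>Half of injectivity: x and y are linked modulo \<open>s\<close> through their common
  multiple. The mirror image links them modulo \<open>r\<close>.\<close>

lemma congruent_if_mult_e_eq:
  assumes "x \<in> carrier R" "y \<in> carrier R" "e \<otimes> x = e \<otimes> y"
  shows "(x, y) \<in> s"
  using assms mult_e_s by (metis cong_s congruence_rel_sym congruence_rel_trans)

text \<open>Replacing \<open>e\<close> by 0 modulo \<open>r\<close> turns a + e into a, while a + e
  is \<open>e\<close> itself, which is congruent to 0.\<close>

lemma below_e_r:
  assumes a: "a \<in> carrier R" and le: "induced_le R a e"
  shows "(a, \<zero>) \<in> r"
proof -
  have "(a \<oplus> e, a) \<in> r"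
    using congruence_rel_add[OF cong_r congruence_rel_refl[OF cong_r a] e_zero] a by simp
  then have "(e, a) \<in> r" using le by (simp add: induced_le_def)
  then show ?thesis
    using e_zero by (meson cong_r congruence_rel_sym congruence_rel_trans)
qed

text \<open>Recovers the first component from a sum: modulo \<open>r\<close> both sides vanish, and
  modulo \<open>s\<close> only the summand \<open>b\<close> does.\<close>

lemma mult_e_sum:
  assumes a: "a \<in> carrier R" "induced_le R a e" and b: "b \<in> carrier R" "(b, \<zero>) \<in> s"
  shows "e \<otimes> (a \<oplus> b) = a"
proof (rule eq_if_common)
  show "(e \<otimes> (a \<oplus> b), \<zero>) \<in> r" "(a, \<zero>) \<in> r"
    using a b by (auto intro: mult_e_r below_e_r)
  have "(a \<oplus> b, a) \<in> s"
    using congruence_rel_add[OF cong_s congruence_rel_refl[OF cong_s a(1)] b(2)] a by simp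
  then show "(e \<otimes> (a \<oplus> b), a) \<in> s"
    using mult_e_s[of "a \<oplus> b"] a b by (meson a_closed cong_s congruence_rel_trans)
  show "(a, a) \<in> s" by (rule congruence_rel_refl[OF cong_s a(1)])
qed

lemma isomorphic_product_of_intervals:
  "isomorphic_algs R (prod_alg (interval_alg R e) (interval_alg R (invol R e)))"
proof -
  interpret sw: congruence_splitting R s r "invol R e" by (rule swap)
  let ?P = "prod_alg (interval_alg R e) (interval_alg R (invol R e))"
  let ?h = "\<lambda>x. (e \<otimes> x, invol R e \<otimes> x)"
  have hom: "?h \<in> ring_hom R ?P"
  proof (rule ring_hom_memI)
    fix x y assume x: "x \<in> carrier R" and y: "y \<in> carrier R"
    show "?h x \<in> carrier ?P"
      using x by (simp add: interval_alg_def m_closed e_closed sw.e_closed mult_e_le sw.mult_e_le)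
    show "?h (x \<otimes> y) = ?h x \<otimes>\<^bsub>?P\<^esub> ?h y"
      unfolding mult_e_mult[OF x y] sw.mult_e_mult[OF x y] by (simp add: interval_alg_def)
    show "?h (x \<oplus> y) = ?h x \<oplus>\<^bsub>?P\<^esub> ?h y"
      unfolding mult_e_add[OF x y] sw.mult_e_add[OF x y] by (simp add: interval_alg_def)
  qed (simp add: interval_alg_def r_one e_closed sw.e_closed)
  have inj: "inj_on ?h (carrier R)"
  proof (rule inj_onI)
    fix x y assume "x \<in> carrier R" "y \<in> carrier R" "?h x = ?h y"
    then show "x = y"
      using congruent_if_mult_e_eq[of x y] sw.congruent_if_mult_e_eq[of x y]
      by (intro eq_if_congruent) simp_all
  qed
  have surj: "p \<in> ?h ` carrier R" if "p \<in> carrier ?P" for p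
  proof -
    obtain a b where p: "p = (a, b)"
      and a: "a \<in> carrier R" "induced_le R a e"
      and b: "b \<in> carrier R" "induced_le R b (invol R e)"
      using \<open>p \<in> carrier ?P\<close> by (cases p) (auto simp: interval_alg_def)
    \<comment> \<open>The mirror image of \<open>below_e_r\<close> makes \<open>b\<close> vanish
      modulo \<open>s\<close>, as \<open>mult_e_sum\<close> requires; the second coordinate is the
      mirrored computation, up to the order of the summands.\<close>
    have "p = ?h (a \<oplus> b)"
      using mult_e_sum[OF a b(1) sw.below_e_r[OF b]]
        sw.mult_e_sum[OF b a(1) below_e_r[OF a]] p
      unfolding a_comm[OF b(1) a(1)] by simp
    then show ?thesis by (rule image_eqI) (rule a_closed[OF a(1) b(1)])
  qed
  have "?h ` carrier R = carrier ?P"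
    by (intro equalityI image_subsetI subsetI surj ring_hom_closed[OF hom])
  with hom inj have "?h \<in> ring_iso R ?P"
    by (simp add: ring_iso_def bij_betw_def)
  moreover have "?h \<zero> = \<zero>\<^bsub>?P\<^esub>"
    by (simp add: interval_alg_def r_null e_closed sw.e_closed)
  moreover have "?h (invol R x) = invol ?P (?h x)" if "x \<in> carrier R" for x
    using mult_e_invol[OF that] sw.mult_e_invol[OF that] by (simp add: interval_alg_def)
  ultimately have "?h \<in> alg_iso R ?P"
    by (simp add: alg_iso_def)
  then show ?thesis
    unfolding isomorphic_algs_def by blast
qed

end

theorem theorem15:
  fixes R :: "'a invol_alg" and e :: 'a
  assumes "integral_involutive_near_semiring R"
    and "central R e"
  shows "isomorphic_algs R (prod_alg (interval_alg R e) (interval_alg R (invol R e)))"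
proof -
  interpret integral_involutive_near_semiring R by (rule assms(1))
  \<comment> \<open>As an intersection of relations containing its generating pair, each principal
    congruence contains that pair; centrality gives the rest.\<close>
  interpret congruence_splitting R "principal_congruence R e \<zero>\<^bsub>R\<^esub>"
    "principal_congruence R e \<one>\<^bsub>R\<^esub>" e
    using assms(2)
    by unfold_locales
      (auto simp: central_def complementary_factor_congruences_def principal_congruence_def)
  show ?thesis by (rule isomorphic_product_of_intervals)
qed

end
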